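(* Let $n$ be a positive integer and let $a_1 < a_2 < \cdots < a_k$ ($k \ge 1$) be positive integers with $a_k < (n+1)/2$. If $a_1 \ge \frac{n+1}{4}$, then the circulant graph $C(n; a_1, a_2, \ldots, a_k)$ is semi-transitive.
   Context: All graphs are simple and undirected. For a positive integer $n$ and integers $0 < a_1 < a_2 < \cdots < a_k < (n+1)/2$, the circulant graph $C(n; a_1, \ldots, a_k)$ has vertex set $\{0, 1, \ldots, n-1\}$, and two distinct vertices $i, j$ are adjacent if and only if $(i-j) \bmod n$ or $(j-i) \bmod n$ belongs to $\{a_1, \ldots, a_k\}$. A semi-transitive orientation of a graph is an acyclic orientation of its edges such that for every directed path $v_0 \rightarrow v_1 \rightarrow \cdots \rightarrow v_m$ with $m \ge 2$, either there is no arc between $v_0$ and $v_m$, or there is an arc $v_i \rightarrow v_j$ for all $0 \le i < j \le m$. An undirected graph is semi-transitive if it admits a semi-transitive orientation. *)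

theory Defs
  imports Complex_Main "Graph_Theory.Graph_Theory"
begin

text \<open>
  Simple undirected graphs are the symmetric, loop-free digraphs without parallel arcs
  (\<^locale>\<open>pair_graph\<close>): an edge between \<open>u\<close> and \<open>v\<close> is the pair of arcs
  \<open>(u, v)\<close>, \<open>(v, u)\<close>.
\<close>

text \<open>
  The circulant graph \<open>C(n; a\<^sub>1, \<dots>, a\<^sub>k)\<close> with \<open>A = {a\<^sub>1, \<dots>, a\<^sub>k}\<close>. The differences
  are taken in \<^typ>\<open>int\<close> because subtraction on \<^typ>\<open>nat\<close> truncates.
\<close>
definition circulant :: "nat \<Rightarrow> nat set \<Rightarrow> nat pair_pre_digraph" where
  "circulant n A = \<lparr> pverts = {0..<n},
     parcs = {(i, j). i < n \<and> j < n \<and> i \<noteq> j \<and>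
       ((int i - int j) mod int n \<in> int ` A \<or> (int j - int i) mod int n \<in> int ` A)} \<rparr>"

lemma pair_graph_circulant: "pair_graph (circulant n A)"
proof
  show "finite (parcs (circulant n A))"
    by (rule finite_subset[of _ "{0..<n} \<times> {0..<n}"]) (auto simp: circulant_def)
  show "symmetric (with_proj (circulant n A))"
    by (auto simp: symmetric_def circulant_def intro: symI)
qed (auto simp: circulant_def)

definition orientation_of :: "'a pair_pre_digraph \<Rightarrow> 'a pair_pre_digraph \<Rightarrow> bool" where
  "orientation_of D G \<longleftrightarrow> pverts D = pverts G \<and>
     parcs D \<union> (parcs D)\<inverse> = parcs G \<and> parcs D \<inter> (parcs D)\<inverse> = {}"

text \<open>
  A path \<open>v\<^sub>0 \<rightarrow> \<dots> \<rightarrow> v\<^sub>m\<close> is represented by the list of its \<open>m + 1\<close> vertices.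
\<close>
definition semi_transitive_orientation ::
    "'a pair_pre_digraph \<Rightarrow> 'a pair_pre_digraph \<Rightarrow> bool" where
  "semi_transitive_orientation D G \<longleftrightarrow> orientation_of D G \<and> acyclic (parcs D) \<and>
     (\<forall>m v. 2 \<le> m \<and> length v = m + 1 \<and> vpath v (with_proj D) \<longrightarrow>
        ((v ! 0, v ! m) \<notin> parcs D \<and> (v ! m, v ! 0) \<notin> parcs D) \<or>
        (\<forall>i j. i < j \<and> j \<le> m \<longrightarrow> (v ! i, v ! j) \<in> parcs D))"

definition semi_transitive :: "'a pair_pre_digraph \<Rightarrow> bool" where
  "semi_transitive G \<longleftrightarrow> (\<exists>D. semi_transitive_orientation D G)"

end

theory Submission
  imports Defs
begin

text \<open>
  Orient every edge from its smaller to its larger endpoint; this is acyclic. Write \<open>a\<close> for the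
  least and \<open>b\<close> for the largest jump. As \<open>b \<le> n / 2\<close>, every jump \<open>x\<close> satisfies
  \<open>a \<le> x \<le> n - a\<close>, and so does every arc length \<open>v - u\<close>, which is \<open>x\<close> or \<open>n - x\<close>
  (\<open>circulant_arc_length_bounds\<close>). Here \<open>n - a < 3 a\<close> because \<open>a > n / 4\<close>. A directed path with at least
  three arcs therefore climbs by at least \<open>3 a\<close>, too far for an arc between its ends
  (\<open>increasing_chain_height\<close>), while a path with two arcs whose ends are adjacent is already
  a transitive triangle. So no path violates semi-transitivity.
\<close>

text \<open>
  For \<open>i < j\<close> the two residues in the adjacency condition are \<open>j - i\<close> and \<open>n - (j - i)\<close>. The
  interval \<open>[a, n - a]\<close> is invariant under the reflection \<open>x \<mapsto> n - x\<close>, so it does not matter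
  which of the two is a jump.
\<close>

lemma circulant_arc_length_bounds:
  assumes arc: "(i, j) \<in> parcs (circulant n A)" and "i < j"
    and A: "\<And>x. x \<in> A \<Longrightarrow> a \<le> x \<and> x + a \<le> n"
  shows "i + a \<le> j" and "j + a \<le> i + n"
proof -
  have "i < n" "j < n" and
    mem: "(int i - int j) mod int n \<in> int ` A \<or> (int j - int i) mod int n \<in> int ` A"
    using arc by (auto simp: circulant_def)
  have "(int j - int i) mod int n = int j - int i"
    using \<open>i < j\<close> \<open>j < n\<close> by simp
  moreover have "(int i - int j) mod int n = int i - int j + int n"
  proof -
    have "(int i - int j) mod int n = (int i - int j + int n) mod int n"
      by simp
    also have "\<dots> = int i - int j + int n"
      using \<open>i < j\<close> \<open>j < n\<close> by (intro mod_pos_pos_trivial) auto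
    finally show ?thesis .
  qed
  ultimately obtain x where "x \<in> A" "int x = int i - int j + int n \<or> int x = int j - int i"
    using mem by auto
  with A[OF \<open>x \<in> A\<close>] show "i + a \<le> j" and "j + a \<le> i + n"
    by linarith+
qed

lemma increasing_chain_height:
  fixes f :: "nat \<Rightarrow> nat"
  assumes "\<And>l. l < m \<Longrightarrow> f l + a \<le> f (Suc l)"
  shows "f 0 + m * a \<le> f m"
  using assms
proof (induction m)
  case (Suc m)
  then have "f 0 + m * a \<le> f m" "f m + a \<le> f (Suc m)"
    by auto
  then show ?case
    by simp
qed simp

lemma vwalk_nth_arc:
  assumes "vwalk p G" and "Suc l < length p"
  shows "(p ! l, p ! Suc l) \<in> arcs_ends G"
  using assms
proof (induction arbitrary: l rule: vwalk_induct)
  case (Base u)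
  then show ?case by simp
next
  case (Cons u v es)
  then show ?case by (cases l) auto
qed

text \<open>
  An arc climbs by at most \<open>n - a\<close> and three consecutive arcs by at least \<open>3 * a\<close>; the bound
  \<open>n < 4 * a\<close> is exactly what separates the two. Hence only paths with two arcs can have
  adjacent ends.
\<close>

theorem circulant_semi_transitive_of_long_jumps:
  assumes A: "\<And>x. x \<in> A \<Longrightarrow> a \<le> x \<and> x + a \<le> n" and "n < 4 * a"
  shows "semi_transitive (circulant n A)"
proof -
  define G where "G = circulant n A"
  define D where "D = \<lparr> pverts = pverts G, parcs = {(i, j) \<in> parcs G. i < j} \<rparr>"
  have arcD: "(i, j) \<in> parcs D \<longleftrightarrow> (i, j) \<in> parcs G \<and> i < j" for i j
    by (simp add: D_def)
  have step: "i + a \<le> j" and reach: "j + a \<le> i + n" if "(i, j) \<in> parcs D" for i j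
    using circulant_arc_length_bounds[OF _ _ A] that by (auto simp: arcD G_def)
  have "orientation_of D G"
    by (auto simp: orientation_of_def D_def G_def circulant_def)
  moreover have "acyclic (parcs D)"
    by (rule acyclic_subset[OF wf_acyclic[OF wf_less]]) (auto simp: arcD)
  moreover have "((v ! 0, v ! m) \<notin> parcs D \<and> (v ! m, v ! 0) \<notin> parcs D) \<or>
      (\<forall>i j. i < j \<and> j \<le> m \<longrightarrow> (v ! i, v ! j) \<in> parcs D)"
    if "2 \<le> m" and len: "length v = m + 1" and path: "vpath v (with_proj D)" for m v
  proof -
    have arc: "(v ! l, v ! Suc l) \<in> parcs D" if "l < m" for l
      using vwalk_nth_arc[of v "with_proj D" l] path len that by (auto simp: vpath_def)
    have climb: "v ! 0 + m * a \<le> v ! m"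
      by (rule increasing_chain_height) (rule step[OF arc])
    then have no_back: "(v ! m, v ! 0) \<notin> parcs D"
      by (auto simp: arcD)
    show ?thesis
    proof (cases "m = 2")
      case True
      show ?thesis
      proof (cases "(v ! 0, v ! 2) \<in> parcs D")
        case short: True
        have "(v ! i, v ! j) \<in> parcs D" if "i < j" "j \<le> m" for i j
        proof -
          have "i = 0 \<and> j = 1 \<or> i = 0 \<and> j = 2 \<or> i = 1 \<and> j = 2"
            using that True by auto
          then show ?thesis
            using short arc[of 0] arc[of 1] True by (auto simp: numeral_2_eq_2)
        qed
        then show ?thesis by blast
      qed (use no_back True in simp)
    next
      case False
      then have "3 * a \<le> m * a"
        using \<open>2 \<le> m\<close> by simp
      with climb \<open>n < 4 * a\<close> have "v ! 0 + n < v ! m + a"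
        by linarith
      then have "(v ! 0, v ! m) \<notin> parcs D"
        using reach by fastforce
      with no_back show ?thesis by simp
    qed
  qed
  ultimately show ?thesis
    unfolding semi_transitive_def semi_transitive_orientation_def G_def by blast
qed

theorem theorem2p4:
  fixes n k :: nat and a :: "nat \<Rightarrow> nat"
  assumes "n \<ge> 1" and "k \<ge> 1"
    and "\<forall>i\<in>{1..k}. a i > 0"
    and "strict_mono_on {1..k} a"
    and "real (a k) < (real n + 1) / 2"
    and "real (a 1) \<ge> (real n + 1) / 4"
  shows "semi_transitive (circulant n (a ` {1..k}))"
proof (rule circulant_semi_transitive_of_long_jumps)
  have "2 * a k \<le> n"
    using assms(5) by (simp add: field_simps flip: of_nat_mult of_nat_Suc)
  moreover have "a 1 \<le> a i" "a i \<le> a k" if "i \<in> {1..k}" for i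
    using strict_mono_on_leD[OF assms(4)] that by auto
  ultimately show "a 1 \<le> x \<and> x + a 1 \<le> n" if "x \<in> a ` {1..k}" for x
    using that by fastforce
  show "n < 4 * a 1"
    using assms(6) by (simp add: field_simps flip: of_nat_mult of_nat_Suc)
qed

end
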